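(* Let $\mathscr{A}$ be an infinite set of positive integers and, for every positive integer $n$, let $\tau_n$ denote the smallest element of $\mathscr{A}$ which does not divide $n$. Let $$\underline{\mathbf{d}}(\mathscr{A}) := \liminf_{N \rightarrow + \infty} \frac{1}{N} \sum_{a \in \mathscr{A},\ a \leq N} 1$$ be the lower asymptotic density of $\mathscr{A}$. Suppose that $\underline{\mathbf{d}}(\mathscr{A}) > 1 - \log 2$. Then the average limit $$\lim_{N \to +\infty} \frac{1}{N}\sum_{n=1}^{N} \tau_n$$ is an irrational number. In particular, the numbers $$\ell_1 := \sum_{n \in \mathbb{N}}\frac{1}{\operatorname{lcm}(1 , 2 , \dots , n)} \qquad\text{and}\qquad \ell_2 := \sum_{n \in \mathbb{N}}\frac{1}{\prod_{p \text{ prime},\, p \leq n} p}$$ are irrational.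
   Context: $\mathbb{N} = \{0, 1, 2, \dots\}$ includes $0$. The least common multiple and the product of the elements of the empty set are, by convention, equal to $1$. $\log$ is the natural logarithm. *)

theory Defs
  imports "HOL-Library.Extended_Real" "HOL-Library.Liminf_Limsup" "HOL-Computational_Algebra.Primes"
begin

(* Taken in the extended reals, since liminf needs a complete lattice.
   The term at N = 0, which is 0 / 0 = 0, does not affect the liminf. *)
definition lower_density :: "nat set \<Rightarrow> ereal" where
  "lower_density A = liminf (\<lambda>N. ereal (real (card {a \<in> A. a \<le> N}) / real N))"

(* Only meaningful when some element of A fails to divide n; this is automatic
   for infinite A and n > 0. *)
definition tau :: "nat set \<Rightarrow> nat \<Rightarrow> nat" where
  "tau A n = (LEAST a. a \<in> A \<and> \<not> a dvd n)"

definition ell1_term :: "nat \<Rightarrow> real" where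
  "ell1_term n = 1 / real (Lcm {1..n})"

definition ell2_term :: "nat \<Rightarrow> real" where
  "ell2_term n = 1 / real (\<Prod>p | prime p \<and> p \<le> n. p)"

definition ell1 :: real where
  "ell1 = (\<Sum>n. ell1_term n)"

definition ell2 :: real where
  "ell2 = (\<Sum>n. ell2_term n)"

end

theory Submission
  imports Defs "HOL-Analysis.Analysis" "HOL-Real_Asymp.Real_Asymp"
begin

text \<open>
  Write \<open>l m\<close> for the least common multiple of the elements of \<open>A\<close> that are at most \<open>m\<close>. Since
  \<open>tau A n > m\<close> holds exactly when \<open>l m\<close> divides \<open>n\<close>, the sum of \<open>tau A n\<close> over \<open>n \<le> N\<close> is
  \<open>\<Sum>m. N div l m\<close>, and dominated convergence gives the mean value \<open>L = (\<Sum>m. 1 / l m)\<close>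
  (lemma \<open>average_tau\<close>).

  Suppose that \<open>L\<close> is rational with denominator \<open>b\<close>. As \<open>l k\<close> divides \<open>l m\<close> for \<open>k \<le> m\<close>, the
  number \<open>b * l m * (\<Sum>k>m. 1 / l k)\<close> is a positive integer, so the tails
  \<open>\<Sum>k>m. l m / l k\<close> are all at least \<open>1 / b\<close>. Irrationality therefore follows once these tails
  come arbitrarily close to zero. This happens if many large primes enter the chain \<open>l\<close>: suppose that
  for some \<open>\<alpha> > 1/2\<close> and all large \<open>N\<close> at least \<open>N powr \<alpha>\<close> primes exceeding \<open>N powr \<alpha>\<close> divide
  \<open>l N\<close>. Cutting \<open>{0..N}\<close> into about \<open>sqrt N\<close> blocks of length \<open>sqrt N\<close>, four of these primes
  enter within one block. If \<open>m + 1\<close> is the time when the first of them enters, the ratio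
  \<open>l m / l k\<close> is at most \<open>N powr (-\<alpha>)\<close> immediately, at most \<open>N powr (-4 * \<alpha>)\<close> after
  \<open>sqrt N\<close> further steps, and at most \<open>1 / k^2\<close> for \<open>k \<ge> N^2\<close>. The contributions of these three
  ranges, the middle one having fewer than \<open>N^2\<close> terms, tend to zero (lemma \<open>exists_small_tail\<close>).

  The density hypothesis supplies the primes. By Mertens' estimates the integers up to \<open>N\<close> having a prime
  factor above \<open>sqrt N\<close> have density \<open>ln 2\<close>, and by continuity those having one above
  \<open>N powr a\<close>, for \<open>a\<close> slightly larger than \<open>1/2\<close>, have density close to \<open>ln 2\<close>. A set of lower
  density greater than \<open>1 - ln 2\<close> contains a positive proportion of them, and since a prime above
  \<open>N powr a\<close> has at most \<open>N powr (1 - a)\<close> multiples up to \<open>N\<close>, of the order of \<open>N powr a\<close>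
  different primes must occur (lemma \<open>density_imp_many_large_primes\<close>).

  For the set of all positive integers, of density \<open>1\<close>, the chain is that of \<open>ell1\<close>. The primorials
  have the same prime divisors as these least common multiples, and the criterion looks only at prime
  divisors, so it covers \<open>ell2\<close> as well.
\<close>

section \<open>Mertens' first theorem\<close>

definition primes_upto :: "real \<Rightarrow> nat set" where
  "primes_upto x = {p. prime p \<and> real p \<le> x}"

definition primes_between :: "real \<Rightarrow> real \<Rightarrow> nat set" where
  "primes_between x y = {p. prime p \<and> x < real p \<and> real p \<le> y}"

lemma finite_primes_upto [simp]: "finite (primes_upto x)"
proof (rule finite_subset)
  show "primes_upto x \<subseteq> {..nat \<lfloor>x\<rfloor>}"
    by (auto simp: primes_upto_def le_nat_floor)
qed simp

lemma finite_primes_between [simp]: "finite (primes_between x y)"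
  by (rule finite_subset[OF _ finite_primes_upto[of y]])
     (auto simp: primes_between_def primes_upto_def)

lemma prod_distinct_primes_dvd:
  assumes "finite P" "\<And>p. p \<in> P \<Longrightarrow> prime p" "\<And>p. p \<in> P \<Longrightarrow> p dvd n"
  shows   "\<Prod>P dvd (n::nat)"
  using assms
proof (induction P)
  case (insert p P)
  have "coprime p (\<Prod>P)"
    using insert by (intro prod_coprime_right) (metis insertCI primes_coprime)
  then show ?case
    using insert by (simp add: divides_mult)
qed simp

text \<open>
  Chebyshev's bound: the primes in \<open>(m + 1, 2m + 1]\<close> all divide the central binomial coefficient
  \<open>(2m + 1) choose m\<close>, which is at most \<open>4^m\<close> because it occurs twice in a row of Pascal's triangle
  with sum \<open>2 * 4^m\<close>.
\<close>
lemma primorial_le: "(\<Prod>p | prime p \<and> p \<le> n. p) \<le> 4 ^ n"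
proof (induction n rule: less_induct)
  case (less n)
  have fin: "finite {p::nat. prime p \<and> p \<le> k}" for k by (rule finite_subset[of _ "{..k}"]) auto
  consider "n \<le> 2" | "n > 2" "even n" | "n > 2" "odd n" by linarith
  then show ?case
  proof cases
    case 1
    have "{p::nat. prime p \<and> p \<le> n} = (if n = 2 then {2} else {})"
      using 1 by (auto dest: prime_ge_2_nat)
    then show ?thesis by auto
  next
    case 2
    have "{p. prime p \<and> p \<le> n} = {p. prime p \<and> p \<le> n - 1}"
      using 2 by (auto simp: le_eq_less_or_eq prime_odd_nat)
    moreover have "(\<Prod>p | prime p \<and> p \<le> n - 1. p) \<le> 4 ^ (n - 1)"
      using less 2 by simp
    moreover have "(4::nat) ^ (n - 1) \<le> 4 ^ n" by (intro power_increasing) auto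
    ultimately show ?thesis by (metis order_trans)
  next
    case 3
    then obtain m where m: "n = 2 * m + 1" by (elim oddE)
    have m0: "m > 0" using 3 m by auto
    let ?Q = "{p. prime p \<and> Suc m < p \<and> p \<le> n}"
    have split: "{p. prime p \<and> p \<le> n} = {p. prime p \<and> p \<le> Suc m} \<union> ?Q"
      using m by auto
    have "\<Prod>?Q dvd (n choose m)"
    proof (rule prod_distinct_primes_dvd)
      fix p assume p: "p \<in> ?Q"
      have "p dvd fact n" using p by (auto simp: prime_dvd_fact_iff)
      also have "fact n = fact m * fact (n - m) * (n choose m)"
        using binomial_fact_lemma[of m n] m by simp
      finally show "p dvd (n choose m)"
        using p m by (auto simp: prime_dvd_mult_iff prime_dvd_fact_iff simp del: fact_Suc)
    qed (auto intro: finite_subset[of _ "{..n}"])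
    then have "\<Prod>?Q \<le> (n choose m)"
      using m by (intro dvd_imp_le) auto
    also have "(n choose m) \<le> 4 ^ m"
    proof -
      have "(n choose m) + (n choose (Suc m)) \<le> (\<Sum>k\<le>n. n choose k)"
        using m by (subst sum.subset_diff[of "{m, Suc m}"]) auto
      also have "\<dots> = 2 * 4 ^ m"
        using choose_row_sum[of n] m by (simp add: power_mult)
      finally show ?thesis
        using m binomial_symmetric[of m n] by simp
    qed
    finally have Q: "\<Prod>?Q \<le> 4 ^ m" .
    have "(\<Prod>p | prime p \<and> p \<le> n. p) = (\<Prod>p | prime p \<and> p \<le> Suc m. p) * \<Prod>?Q"
      unfolding split by (rule prod.union_disjoint) (auto intro: finite_subset[of _ "{..n}"] fin)
    also have "\<dots> \<le> 4 ^ Suc m * 4 ^ m"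
      using less[of "Suc m"] m0 m Q by (intro mult_mono) auto
    also have "\<dots> = 4 ^ n" by (simp add: m power_add mult_2)
    finally show ?thesis .
  qed
qed

lemma sum_ln_primes_le: "(\<Sum>p\<in>primes_upto (real n). ln (real p)) \<le> real n * ln 4"
proof -
  have pos: "\<And>p. p \<in> primes_upto (real n) \<Longrightarrow> real p > 0"
    by (auto simp: primes_upto_def prime_gt_0_nat)
  have "(\<Sum>p\<in>primes_upto (real n). ln (real p)) = ln (\<Prod>p\<in>primes_upto (real n). real p)"
    using pos by (subst ln_prod) auto
  also have "(\<Prod>p\<in>primes_upto (real n). real p) = real (\<Prod>p | prime p \<and> p \<le> n. p)"
    by (simp add: primes_upto_def)
  also have "ln \<dots> \<le> ln (real (4 ^ n))"
    using primorial_le[of n] by (subst ln_le_cancel_iff) (auto simp: prime_gt_0_nat intro!: prod_pos simp del: of_nat_prod of_nat_power)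
  also have "\<dots> = real n * ln 4" by (simp add: ln_realpow)
  finally show ?thesis .
qed

text \<open>
  Legendre's formula in recursive form: the multiples of \<open>p\<close> among the factors \<open>1, ..., n\<close> are
  \<open>p\<close> times \<open>1, ..., n div p\<close>.
\<close>
lemma multiplicity_fact_rec:
  assumes "prime p"
  shows   "multiplicity p (fact n :: nat) = n div p + multiplicity p (fact (n div p) :: nat)"
proof (induction n)
  case (Suc n)
  have pe: "prime_elem p" using assms by simp
  have "multiplicity p (fact (Suc n) :: nat) = multiplicity p (Suc n) + multiplicity p (fact n :: nat)"
    unfolding fact_Suc using pe by (subst prime_elem_multiplicity_mult_distrib) (auto simp del: of_nat_Suc)
  also note Suc
  finally have IH: "multiplicity p (fact (Suc n) :: nat) =
      multiplicity p (Suc n) + (n div p + multiplicity p (fact (n div p) :: nat))" .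
  show ?case
  proof (cases "p dvd Suc n")
    case True
    then obtain q where q: "Suc n = p * q" by blast
    have "Suc n div p = q" using q assms by (simp add: prime_gt_0_nat)
    moreover have "Suc n div p = Suc (n div p)" using True by (simp add: div_Suc dvd_eq_mod_eq_0)
    ultimately have nq: "q = Suc (n div p)" by simp
    have "multiplicity p (Suc n) = Suc (multiplicity p q)"
      unfolding q using assms nq by (intro multiplicity_times_same) (auto simp: prime_gt_0_nat)
    moreover have "multiplicity p (fact q :: nat) = multiplicity p q + multiplicity p (fact (n div p) :: nat)"
      unfolding nq fact_Suc using pe by (subst prime_elem_multiplicity_mult_distrib) (auto simp del: of_nat_Suc)
    ultimately show ?thesis using IH \<open>Suc n div p = q\<close> nq by simp
  next
    case False
    then have "multiplicity p (Suc n) = 0" by (simp add: not_dvd_imp_multiplicity_0)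
    moreover have "Suc n div p = n div p" using False by (simp add: div_Suc dvd_eq_mod_eq_0)
    ultimately show ?thesis using IH by simp
  qed
qed simp

lemma multiplicity_fact_le:
  assumes "prime p"
  shows   "(p - 1) * multiplicity p (fact n :: nat) \<le> n"
proof (induction n rule: less_induct)
  case (less n)
  show ?case
  proof (cases "n = 0")
    case False
    let ?q = "n div p"
    have "p > 1" using assms prime_gt_1_nat by blast
    then have "?q < n" using False by simp
    then have "(p - 1) * multiplicity p (fact ?q :: nat) \<le> ?q" by (rule less)
    then have "(p - 1) * (?q + multiplicity p (fact ?q :: nat)) \<le> (p - 1) * ?q + ?q"
      by (simp add: distrib_left)
    also have "\<dots> = p * ?q" using \<open>p > 1\<close> by (cases p) auto
    also have "\<dots> \<le> n" by simp
    finally show ?thesis by (subst multiplicity_fact_rec[OF assms])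
  qed simp
qed

lemma ln_fact_eq_sum_primes:
  "ln (fact n :: real) = (\<Sum>p\<in>primes_upto (real n). real (multiplicity p (fact n :: nat)) * ln (real p))"
proof -
  have pf: "prime_factors (fact n :: nat) = primes_upto (real n)"
    by (auto simp: primes_upto_def prime_factors_dvd prime_dvd_fact_iff)
  have pos: "\<And>p. p \<in> primes_upto (real n) \<Longrightarrow> real p > 0"
    by (auto simp: primes_upto_def prime_gt_0_nat)
  have "(fact n :: nat) = (\<Prod>p\<in>primes_upto (real n). p ^ multiplicity p (fact n :: nat))"
    using prime_factorization_nat[of "fact n"] pf by simp
  then have "(fact n :: real) = (\<Prod>p\<in>primes_upto (real n). real p ^ multiplicity p (fact n :: nat))"
    by (metis (no_types, lifting) of_nat_fact of_nat_power of_nat_prod prod.cong)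
  then show ?thesis
    using pos by (simp add: ln_prod ln_realpow)
qed

lemma ln_fact_bounds:
  assumes "n > 0"
  shows   "real n * ln (real n) - real n \<le> ln (fact n)" "ln (fact n) \<le> real n * ln (real n)"
proof -
  show "real n * ln (real n) - real n \<le> ln (fact n)"
    using assms
  proof (induction n rule: nat_induct_non_zero)
    case (Suc n)
    have "ln (1 + 1 / real n) \<le> 1 / real n" using Suc by (intro ln_add_one_self_le_self) auto
    moreover have "1 + 1 / real n = real (Suc n) / real n" using Suc by (simp add: field_simps)
    ultimately have "ln (real (Suc n)) - ln (real n) \<le> 1 / real n"
      using Suc by (simp add: ln_div)
    then have "real n * (ln (real (Suc n)) - ln (real n)) \<le> 1"
      using Suc by (simp add: field_simps)
    then have "real (Suc n) * ln (real (Suc n)) - real (Suc n) \<le> ln (real (Suc n)) + ln (fact n)"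
      using Suc by (simp add: algebra_simps)
    also have "\<dots> = ln (fact (Suc n))" by (simp add: ln_mult)
    finally show ?case .
  qed simp
  have "(fact n :: real) \<le> real n ^ n" using fact_le_power[of n, where ?'a = real] by simp
  then have "ln (fact n :: real) \<le> ln (real n ^ n)" using assms by (subst ln_le_cancel_iff) auto
  then show "ln (fact n) \<le> real n * ln (real n)" using assms by (simp add: ln_realpow)
qed

text \<open>
  Compare \<open>ln n! = n * ln n + O(n)\<close> with its prime factorization. The exponent of \<open>p\<close> is more than
  \<open>n / p - 1\<close>, where the error \<open>1\<close> adds up to Chebyshev's \<open>\<Sum>p\<le>n. ln p = O(n)\<close>, and at most
  \<open>n / (p - 1) = n * (1 / p + 1 / (p * (p - 1)))\<close>, where the second part adds up to a convergent series.
\<close>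
lemma mertens_first:
  "\<exists>C. \<forall>x\<ge>1. \<bar>(\<Sum>p\<in>primes_upto x. ln (real p) / real p) - ln x\<bar> \<le> C"
proof -
  let ?g = "\<lambda>k::nat. ln (real k) / (real k * (real k - 1))"
  have "summable ?g"
  proof (rule summable_comparison_test_bigo)
    show "summable (\<lambda>n. norm (real n powr (-(3/2))))"
      by (simp add: summable_real_powr_iff)
    show "?g \<in> O(\<lambda>n. real n powr (-(3/2)))" by real_asymp
  qed
  have g0: "?g k \<ge> 0" for k by (cases k) auto
  define C1 where "C1 = suminf ?g"
  have C1: "C1 \<ge> 0" unfolding C1_def using g0 \<open>summable ?g\<close> by (intro suminf_nonneg)
  define C where "C = 2 + C1 + ln 4"
  have nat_bound: "ln (real n) - 1 - C1 \<le> (\<Sum>p\<in>primes_upto (real n). ln (real p) / real p)"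
       "(\<Sum>p\<in>primes_upto (real n). ln (real p) / real p) \<le> ln (real n) + ln 4"
    if n: "n > 0" for n :: nat
  proof -
    let ?P = "primes_upto (real n)"
    have P: "p \<ge> 2" "prime p" if "p \<in> ?P" for p using that by (auto simp: primes_upto_def prime_ge_2_nat)
    have "real n * (\<Sum>p\<in>?P. ln (real p) / real p) - (\<Sum>p\<in>?P. ln (real p))
         = (\<Sum>p\<in>?P. (real n / real p - 1) * ln (real p))"
      by (simp add: sum_distrib_left sum_subtractf algebra_simps)
    also have "\<dots> \<le> (\<Sum>p\<in>?P. real (multiplicity p (fact n :: nat)) * ln (real p))"
    proof (intro sum_mono mult_right_mono)
      fix p assume p: "p \<in> ?P"
      have "real n / real p - 1 \<le> real (n div p)"
        using floor_divide_of_nat_eq[of n p, where ?'a = real] by linarith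
      also have "\<dots> \<le> real (multiplicity p (fact n :: nat))"
        using multiplicity_fact_rec[OF P(2)[OF p], of n] by simp
      finally show "real n / real p - 1 \<le> real (multiplicity p (fact n :: nat))" .
      show "ln (real p) \<ge> 0" using P(1)[OF p] by simp
    qed
    also have "\<dots> \<le> real n * ln (real n)"
      using ln_fact_bounds(2)[OF n] by (simp add: ln_fact_eq_sum_primes)
    finally have "real n * (\<Sum>p\<in>?P. ln (real p) / real p) \<le> real n * (ln (real n) + ln 4)"
      using sum_ln_primes_le[of n] by (simp add: distrib_left)
    then show "(\<Sum>p\<in>?P. ln (real p) / real p) \<le> ln (real n) + ln 4"
      using n by simp
    have "real n * (ln (real n) - 1) \<le> ln (fact n)"
      using ln_fact_bounds(1)[OF n] by (simp add: algebra_simps)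
    also have "\<dots> = (\<Sum>p\<in>?P. real (multiplicity p (fact n :: nat)) * ln (real p))"
      by (rule ln_fact_eq_sum_primes)
    also have "\<dots> \<le> (\<Sum>p\<in>?P. real n * (ln (real p) / real p + ?g p))"
    proof (rule sum_mono)
      fix p assume p: "p \<in> ?P"
      have "real ((p - 1) * multiplicity p (fact n :: nat)) \<le> real n"
        using multiplicity_fact_le[OF P(2)[OF p], of n] by (rule of_nat_mono)
      then have "(real p - 1) * real (multiplicity p (fact n :: nat)) \<le> real n"
        using P(1)[OF p] by (simp add: of_nat_diff)
      then have "real (multiplicity p (fact n :: nat)) \<le> real n / (real p - 1)"
        using P(1)[OF p] by (simp add: field_simps)
      then have "real (multiplicity p (fact n :: nat)) * ln (real p) \<le> real n / (real p - 1) * ln (real p)"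
        using P(1)[OF p] by (intro mult_right_mono) auto
      also have "\<dots> = real n * (ln (real p) / real p + ?g p)"
        using P(1)[OF p] by (simp add: field_simps)
      finally show "real (multiplicity p (fact n :: nat)) * ln (real p) \<le> real n * (ln (real p) / real p + ?g p)" .
    qed
    also have "\<dots> = real n * ((\<Sum>p\<in>?P. ln (real p) / real p) + (\<Sum>p\<in>?P. ?g p))"
      by (simp add: sum.distrib flip: sum_distrib_left)
    also have "\<dots> \<le> real n * ((\<Sum>p\<in>?P. ln (real p) / real p) + C1)"
      unfolding C1_def using g0 \<open>summable ?g\<close>
      by (intro mult_left_mono add_left_mono sum_le_suminf) auto
    finally show "ln (real n) - 1 - C1 \<le> (\<Sum>p\<in>?P. ln (real p) / real p)"
      using n by simp
  qed
  have "\<bar>(\<Sum>p\<in>primes_upto x. ln (real p) / real p) - ln x\<bar> \<le> C" if x: "x \<ge> 1" for x :: real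
  proof -
    define n where "n = nat \<lfloor>x\<rfloor>"
    have n: "n > 0" "real n \<le> x" "x \<le> real n + 1" using x by (auto simp: n_def le_nat_floor; linarith)+
    have "real p \<le> x \<longleftrightarrow> p \<le> n" for p
      using le_nat_floor[of p x] n(2) by (auto simp: n_def)
    then have eq: "primes_upto x = primes_upto (real n)"
      by (simp add: primes_upto_def)
    moreover have "ln (real n) \<le> ln x" using n by simp
    moreover have "ln x \<le> ln (2 * real n)" using n x by (subst ln_le_cancel_iff) auto
    moreover have "ln (2 * real n) = ln 2 + ln (real n)" using n by (simp add: ln_mult)
    moreover have "ln (2::real) \<le> 1" using ln_le_minus_one[of "2::real"] by simp
    moreover have "ln (4::real) \<ge> 0" by simp
    ultimately show ?thesis
      using nat_bound[OF n(1)] C1 unfolding C_def eq by linarith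
  qed
  then show ?thesis by blast
qed

section \<open>Sums of reciprocals of primes over power intervals\<close>

lemma sum_primes_between:
  assumes "x \<le> y" "y \<le> z"
  shows   "sum f (primes_between x z) = sum f (primes_between x y) + sum f (primes_between y z)"
proof -
  have "primes_between x z = primes_between x y \<union> primes_between y z"
    using assms by (auto simp: primes_between_def)
  moreover have "primes_between x y \<inter> primes_between y z = {}"
    by (auto simp: primes_between_def)
  ultimately show ?thesis
    by (simp add: sum.union_disjoint)
qed

text \<open>
  In this range \<open>ln p \<le> b * ln N\<close>, so \<open>1 / p\<close> is at least \<open>ln p / p\<close> divided by \<open>b * ln N\<close>, and
  Mertens' first theorem evaluates the sum of \<open>ln p / p\<close> as \<open>(b - a) * ln N + O(1)\<close>.
\<close>
lemma sum_inverse_primes_lower: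
  "\<exists>C. \<forall>N::nat. \<forall>a b. N \<ge> 2 \<longrightarrow> 0 < a \<longrightarrow> a < b \<longrightarrow>
     (\<Sum>p\<in>primes_between (real N powr a) (real N powr b). 1 / real p) \<ge> 1 - a / b - C / (b * ln (real N))"
proof -
  obtain C where C: "\<And>x. x \<ge> 1 \<Longrightarrow> \<bar>(\<Sum>p\<in>primes_upto x. ln (real p) / real p) - ln x\<bar> \<le> C"
    using mertens_first by blast
  have "(\<Sum>p\<in>primes_between (real N powr a) (real N powr b). 1 / real p) \<ge> 1 - a / b - (2 * C) / (b * ln (real N))"
    if N: "N \<ge> 2" and ab: "0 < a" "a < b" for N :: nat and a b :: real
  proof -
    let ?x = "real N powr a" and ?y = "real N powr b"
    let ?Q = "primes_between ?x ?y"
    have lnN: "ln (real N) > 0" using N by simp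
    have xy: "1 \<le> ?x" "?x \<le> ?y" using N ab by (auto intro!: ge_one_powr_ge_zero powr_mono)
    have "primes_upto ?y = primes_upto ?x \<union> ?Q"
      using xy by (auto simp: primes_upto_def primes_between_def)
    moreover have "primes_upto ?x \<inter> ?Q = {}"
      by (auto simp: primes_upto_def primes_between_def)
    ultimately have "(\<Sum>p\<in>primes_upto ?y. ln (real p) / real p) =
        (\<Sum>p\<in>primes_upto ?x. ln (real p) / real p) + (\<Sum>p\<in>?Q. ln (real p) / real p)"
      by (simp add: sum.union_disjoint)
    moreover have "\<bar>(\<Sum>p\<in>primes_upto ?x. ln (real p) / real p) - a * ln (real N)\<bar> \<le> C"
      using C[of ?x] xy N by (simp add: ln_powr)
    moreover have "\<bar>(\<Sum>p\<in>primes_upto ?y. ln (real p) / real p) - b * ln (real N)\<bar> \<le> C"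
      using C[of ?y] xy N by (simp add: ln_powr)
    ultimately have "(b - a) * ln (real N) - 2 * C \<le> (\<Sum>p\<in>?Q. ln (real p) / real p)"
      unfolding left_diff_distrib by linarith
    also have "\<dots> \<le> (\<Sum>p\<in>?Q. b * ln (real N) * (1 / real p))"
    proof (rule sum_mono)
      fix p assume "p \<in> ?Q"
      then have p: "prime p" "real p \<le> ?y" by (auto simp: primes_between_def)
      have p0: "real p > 0" using p(1) prime_gt_0_nat by simp
      have "ln (real p) \<le> ln ?y" using p(2) p0 N by (subst ln_le_cancel_iff) auto
      also have "\<dots> = b * ln (real N)" using N by (simp add: ln_powr)
      finally show "ln (real p) / real p \<le> b * ln (real N) * (1 / real p)"
        using p0 by (simp add: divide_right_mono)
    qed
    also have "\<dots> = b * ln (real N) * (\<Sum>p\<in>?Q. 1 / real p)"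
      by (simp only: sum_distrib_left)
    finally have "((b - a) * ln (real N) - 2 * C) / (b * ln (real N)) \<le> (\<Sum>p\<in>?Q. 1 / real p)"
      using ab lnN by (simp add: pos_divide_le_eq mult.commute)
    moreover have "((b - a) * ln (real N) - 2 * C) / (b * ln (real N)) = 1 - a / b - (2 * C) / (b * ln (real N))"
      using ab lnN by (simp add: field_simps)
    ultimately show ?thesis by simp
  qed
  then show ?thesis by blast
qed

text \<open>
  The preceding bound tends to \<open>1 - a / b\<close> only, which is less than \<open>ln (b / a)\<close>. The loss vanishes when
  the interval of exponents is cut into \<open>K\<close> pieces in geometric progression: each piece yields
  \<open>1 - 1 / r\<close> with \<open>r = (b / a) powr (1 / K)\<close>, and \<open>K * (1 - 1 / r)\<close> tends to \<open>ln (b / a)\<close>.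
\<close>
lemma eventually_sum_inverse_primes_gt:
  assumes ab: "0 < a" "a < b" and c: "c < ln (b / a)"
  shows   "eventually (\<lambda>N::nat. c < (\<Sum>p\<in>primes_between (real N powr a) (real N powr b). 1 / real p)) sequentially"
proof -
  obtain C where C: "\<And>N a b. N \<ge> 2 \<Longrightarrow> 0 < a \<Longrightarrow> a < b \<Longrightarrow>
     (\<Sum>p\<in>primes_between (real N powr a) (real N powr b). 1 / real p) \<ge> 1 - a / b - C / (b * ln (real N))"
    using sum_inverse_primes_lower by blast
  define t where "t = ln (b / a)"
  have t: "t > 0" using ab by (simp add: t_def)
  have "(\<lambda>K::nat. real K * (1 - exp (- t / real K))) \<longlonglongrightarrow> t"
    by real_asymp
  then have "eventually (\<lambda>K::nat. c < real K * (1 - exp (- t / real K))) sequentially"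
    using c unfolding t_def by (rule order_tendstoD)
  then have "\<exists>K::nat. c < real K * (1 - exp (- t / real K)) \<and> K > 0"
    by (intro eventually_happens'[OF sequentially_bot] eventually_conj eventually_gt_at_top)
  then obtain K :: nat where K: "K > 0" "c < real K * (1 - exp (- t / real K))"
    by blast
  define r where "r = exp (t / real K)"
  have r: "r > 1" using t K by (simp add: r_def)
  define e where "e = (\<lambda>j. a * r ^ j)"
  have e0: "e 0 = a" by (simp add: e_def)
  have eK: "e K = b"
    using ab K by (simp add: e_def r_def t_def flip: exp_of_nat_mult)
  have e_pos: "e j \<ge> a" "e j < e (Suc j)" "e j / e (Suc j) = 1 / r" for j
    using ab r by (auto simp: e_def intro: one_le_power)
  have slices: "(\<Sum>j<k. \<Sum>p\<in>primes_between (real N powr e j) (real N powr e (Suc j)). 1 / real p)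
        = (\<Sum>p\<in>primes_between (real N powr a) (real N powr e k). 1 / real p)" if "N \<ge> 2" for k N :: nat
  proof (induction k)
    case 0
    have "primes_between (real N powr a) (real N powr a) = {}"
      by (auto simp: primes_between_def)
    then show ?case by (simp add: e0)
  next
    case (Suc k)
    have "real N powr a \<le> real N powr e k" "real N powr e k \<le> real N powr e (Suc k)"
      using that e_pos[of k] by (auto intro!: powr_mono)
    from sum_primes_between[OF this, of "\<lambda>p. 1 / real p"] show ?case
      using Suc by simp
  qed
  have lower: "real K * (1 - 1 / r) - real K * (\<bar>C\<bar> / (a * ln (real N)))
      \<le> (\<Sum>p\<in>primes_between (real N powr a) (real N powr b). 1 / real p)" if N: "N \<ge> 2" for N :: nat
  proof -
    have lnN: "ln (real N) > 0" using N by simp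
    have "real K * (1 - 1 / r) - real K * (\<bar>C\<bar> / (a * ln (real N)))
        = (\<Sum>j<K. 1 - 1 / r - \<bar>C\<bar> / (a * ln (real N)))"
      by (simp add: right_diff_distrib)
    also have "\<dots> \<le> (\<Sum>j<K. \<Sum>p\<in>primes_between (real N powr e j) (real N powr e (Suc j)). 1 / real p)"
    proof (rule sum_mono)
      fix j
      have ej: "0 < e j" "a \<le> e (Suc j)" using e_pos(1)[of j] e_pos(1)[of "Suc j"] ab by auto
      have "C / (e (Suc j) * ln (real N)) \<le> \<bar>C\<bar> / (a * ln (real N))"
        using ej ab lnN by (intro frac_le mult_right_mono) auto
      then show "1 - 1 / r - \<bar>C\<bar> / (a * ln (real N))
           \<le> (\<Sum>p\<in>primes_between (real N powr e j) (real N powr e (Suc j)). 1 / real p)"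
        using C[OF N ej(1) e_pos(2)] e_pos(3)[of j] by simp
    qed
    also have "\<dots> = (\<Sum>p\<in>primes_between (real N powr a) (real N powr b). 1 / real p)"
      using slices[OF N, of K] eK by simp
    finally show ?thesis .
  qed
  have "(\<lambda>N::nat. real K * (1 - 1 / r) - real K * (\<bar>C\<bar> / (a * ln (real N)))) \<longlonglongrightarrow> real K * (1 - 1 / r) - real K * 0"
    using ab by (intro tendsto_intros) real_asymp
  moreover have "c < real K * (1 - 1 / r) - real K * 0"
    using K by (simp add: r_def exp_minus inverse_eq_divide)
  ultimately have "eventually (\<lambda>N::nat. c < real K * (1 - 1 / r) - real K * (\<bar>C\<bar> / (a * ln (real N)))) sequentially"
    by (rule order_tendstoD)
  with eventually_ge_at_top[of 2] show ?thesis
  proof eventually_elim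
    case (elim N)
    then show ?case using lower[of N] by linarith
  qed
qed

section \<open>Large prime factors of the elements of a dense set\<close>

lemma card_multiples:
  assumes "d > 0"
  shows   "card {n \<in> {1..N}. d dvd n} = N div (d::nat)"
proof -
  have "{n \<in> {1..N}. d dvd n} = (\<lambda>k. d * k) ` {1..N div d}"
  proof (intro equalityI subsetI)
    fix n assume "n \<in> {n \<in> {1..N}. d dvd n}"
    then obtain k where "n = d * k" "1 \<le> n" "n \<le> N" by auto
    then have "k \<in> {1..N div d}" using assms by (auto simp: less_eq_div_iff_mult_less_eq mult.commute Suc_le_eq)
    then show "n \<in> (\<lambda>k. d * k) ` {1..N div d}" using \<open>n = d * k\<close> by blast
  qed (use assms in \<open>auto simp: less_eq_div_iff_mult_less_eq mult.commute Suc_le_eq\<close>)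
  also have "card \<dots> = N div d"
    using assms by (subst card_image) (auto simp: inj_on_def)
  finally show ?thesis .
qed

lemma Lcm_upto_pos:
  assumes "\<forall>a\<in>A. 0 < (a::nat)"
  shows   "Lcm {a \<in> A. a \<le> n} > 0"
proof -
  have "finite {a \<in> A. a \<le> n}" by (rule finite_subset[of _ "{..n}"]) auto
  then show ?thesis using assms by (subst neq0_conv[symmetric], subst Lcm_0_iff) auto
qed

definition large_primes :: "(nat \<Rightarrow> nat) \<Rightarrow> real \<Rightarrow> nat \<Rightarrow> nat set" where
  "large_primes l \<alpha> N = {p. prime p \<and> real N powr \<alpha> < real p \<and> p dvd l N}"

text \<open>
  The product of two primes above \<open>sqrt N\<close> exceeds \<open>N\<close>, so the sets of multiples are disjoint.
\<close>
lemma card_with_large_prime_factor: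
  assumes fin: "finite P" and P: "\<And>p. p \<in> P \<Longrightarrow> prime p \<and> sqrt (real N) < real p"
  shows   "card {n \<in> {1..N}. \<exists>p\<in>P. p dvd n} = (\<Sum>p\<in>P. N div p)"
proof -
  have "{n \<in> {1..N}. p dvd n} \<inter> {n \<in> {1..N}. q dvd n} = {}" if pq: "p \<in> P" "q \<in> P" "p \<noteq> q" for p q
  proof -
    have "\<not> (p dvd n \<and> q dvd n)" if n: "n \<in> {1..N}" for n
    proof
      assume "p dvd n \<and> q dvd n"
      moreover have "coprime p q" using P pq by (intro primes_coprime) auto
      ultimately have "p * q dvd n" by (simp add: divides_mult)
      then have "p * q \<le> N" using n by (meson atLeastAtMost_iff dvd_imp_le le_trans less_le_trans zero_less_one)
      then have "real p * real q \<le> real N" by (metis of_nat_le_iff of_nat_mult)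
      moreover have "sqrt (real N) * sqrt (real N) < real p * real q"
        using P pq by (intro mult_strict_mono) (auto simp: prime_gt_0_nat)
      ultimately show False by simp
    qed
    then show ?thesis by blast
  qed
  then have "card (\<Union>p\<in>P. {n \<in> {1..N}. p dvd n}) = (\<Sum>p\<in>P. card {n \<in> {1..N}. p dvd n})"
    using fin by (intro card_UN_disjoint) auto
  also have "(\<Union>p\<in>P. {n \<in> {1..N}. p dvd n}) = {n \<in> {1..N}. \<exists>p\<in>P. p dvd n}" by blast
  also have "(\<Sum>p\<in>P. card {n \<in> {1..N}. p dvd n}) = (\<Sum>p\<in>P. N div p)"
    using P by (intro sum.cong card_multiples) (auto simp: prime_gt_0_nat)
  finally show ?thesis .
qed

text \<open>
  By inclusion and exclusion at least \<open>(c + d - 1) * N - N powr b\<close> elements of \<open>A\<close> up to \<open>N\<close> have a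
  prime factor between \<open>N powr a\<close> and \<open>N powr b\<close>, and each such prime accounts for at most
  \<open>N powr (1 - a)\<close> of them. The upper end \<open>N powr b\<close> keeps the total rounding error in
  \<open>N div p\<close>, at most one for each prime, of smaller order than \<open>N\<close> when \<open>b < 1\<close>.
\<close>
lemma card_large_primes_lower_bound:
  fixes N :: nat and a b c d :: real
  assumes A: "\<forall>a\<in>A. 0 < a" and N: "N > 0" and ab: "1 / 2 < a" "a < b"
    and dens: "d * real N \<le> real (card {a \<in> A. a \<le> N})"
    and c: "c \<le> (\<Sum>p\<in>primes_between (real N powr a) (real N powr b). 1 / real p)"
  shows "(c + d - 1) * real N - real N powr b
      \<le> real (card (large_primes (\<lambda>N. Lcm {a \<in> A. a \<le> N}) a N)) * real N powr (1 - a)"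
proof -
  define P where "P = primes_between (real N powr a) (real N powr b)"
  define B where "B = {n \<in> {1..N}. \<exists>p\<in>P. p dvd n}"
  define S where "S = {a \<in> A. a \<le> N}"
  define L where "L = large_primes (\<lambda>N. Lcm {a \<in> A. a \<le> N}) a N"
  have finP [simp]: "finite P" by (simp add: P_def)
  have S: "S \<subseteq> {1..N}" using A by (auto simp: S_def Suc_le_eq)
  then have finS: "finite S" by (rule finite_subset) simp
  have P: "prime p" "real N powr a < real p" "sqrt (real N) < real p" if "p \<in> P" for p
  proof -
    show p: "prime p" "real N powr a < real p" using that by (auto simp: P_def primes_between_def)
    have "sqrt (real N) = real N powr (1/2)" by (simp add: powr_half_sqrt)
    also have "\<dots> \<le> real N powr a" using N ab by (intro powr_mono) auto
    finally show "sqrt (real N) < real p" using p by simp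
  qed
  have cardP: "real (card P) \<le> real N powr b"
  proof -
    have "P \<subseteq> {1..nat \<lfloor>real N powr b\<rfloor>}"
      by (auto simp: P_def primes_between_def le_nat_floor Suc_le_eq prime_gt_0_nat)
    then have "card P \<le> card {1..nat \<lfloor>real N powr b\<rfloor>}" by (intro card_mono) auto
    then show ?thesis by (simp add: le_nat_iff le_floor_iff)
  qed
  have "c * real N - real N powr b \<le> (\<Sum>p\<in>P. 1 / real p) * real N - real (card P)"
    using c cardP unfolding P_def by (intro diff_mono mult_right_mono) auto
  also have "\<dots> = (\<Sum>p\<in>P. real N / real p - 1)"
    by (simp add: sum_subtractf sum_distrib_right)
  also have "\<dots> \<le> (\<Sum>p\<in>P. real (N div p))"
  proof (rule sum_mono)
    fix p show "real N / real p - 1 \<le> real (N div p)"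
      using floor_divide_of_nat_eq[of N p, where ?'a = real] by linarith
  qed
  also have "\<dots> = real (card B)"
    unfolding B_def using P by (subst card_with_large_prime_factor) auto
  finally have cardB: "c * real N - real N powr b \<le> real (card B)" .
  have "card (S \<union> B) \<le> card {1..N}" using S by (intro card_mono) (auto simp: B_def)
  moreover have "card S + card B = card (S \<union> B) + card (S \<inter> B)"
    using finS by (intro card_Un_Int) (auto simp: B_def)
  ultimately have "real (card S) + real (card B) \<le> real N + real (card (S \<inter> B))"
    by simp
  then have lower: "(c + d - 1) * real N - real N powr b \<le> real (card (S \<inter> B))"
    using cardB dens unfolding S_def by (simp add: algebra_simps)
  have Lcm0: "Lcm S \<noteq> 0" using S finS by (subst Lcm_0_iff_nat) auto
  have "L \<subseteq> {p. p dvd Lcm S}" by (auto simp: L_def large_primes_def S_def)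
  moreover have "finite {p. p dvd Lcm S}" unfolding S_def by (rule finite_divisors_nat[OF Lcm_upto_pos[OF A]])
  ultimately have finL: "finite L" by (rule finite_subset)
  have "S \<inter> B \<subseteq> (\<Union>p\<in>L. {n \<in> {1..N}. p dvd n})"
  proof
    fix n assume n: "n \<in> S \<inter> B"
    then obtain p where p: "p \<in> P" "p dvd n" "n \<in> {1..N}" by (auto simp: B_def)
    have "p dvd Lcm S" using n p dvd_Lcm[of n S] by (auto intro: dvd_trans)
    then have "p \<in> L" using P[OF p(1)] by (auto simp: L_def large_primes_def S_def)
    then show "n \<in> (\<Union>p\<in>L. {n \<in> {1..N}. p dvd n})" using p by blast
  qed
  then have "card (S \<inter> B) \<le> card (\<Union>p\<in>L. {n \<in> {1..N}. p dvd n})"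
    using finL by (intro card_mono) auto
  also have "\<dots> \<le> (\<Sum>p\<in>L. card {n \<in> {1..N}. p dvd n})" by (rule card_UN_le[OF finL])
  finally have "real (card (S \<inter> B)) \<le> real (\<Sum>p\<in>L. card {n \<in> {1..N}. p dvd n})"
    by (simp only: of_nat_le_iff)
  also have "\<dots> = (\<Sum>p\<in>L. real (N div p))"
    unfolding of_nat_sum by (intro sum.cong refl arg_cong[of _ _ real] card_multiples)
      (auto simp: L_def large_primes_def prime_gt_0_nat)
  also have "\<dots> \<le> (\<Sum>p\<in>L. real N powr (1 - a))"
  proof (rule sum_mono)
    fix p assume "p \<in> L"
    then have p: "real N powr a < real p" "0 < real p"
      by (auto simp: L_def large_primes_def prime_gt_0_nat)
    have "real (N div p) \<le> real N / real p" by (rule of_nat_div_le_of_nat)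
    also have "\<dots> \<le> real N / real N powr a" using p N by (intro divide_left_mono) auto
    also have "\<dots> = real N powr (1 - a)" using N by (simp add: powr_diff)
    finally show "real (N div p) \<le> real N powr (1 - a)" .
  qed
  also have "\<dots> = real (card L) * real N powr (1 - a)" by simp
  finally show ?thesis using lower by (simp add: L_def)
qed

text \<open>
  Take exponents \<open>a > 1/2\<close> and \<open>b < 1\<close> so close to these limits that \<open>ln (b / a)\<close> still exceeds
  \<open>1 - d\<close>. That leaves a constant multiple of \<open>N powr a\<close> primes; passing to a smaller
  exponent \<open>\<alpha>\<close> absorbs the constant.
\<close>
lemma density_imp_many_large_primes:
  assumes A: "\<forall>a\<in>A. 0 < a" and dens: "lower_density A > ereal (1 - ln 2)"
  shows "\<exists>\<alpha>>1/2. eventually (\<lambda>N. real N powr \<alpha> \<le>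
           real (card (large_primes (\<lambda>N. Lcm {a \<in> A. a \<le> N}) \<alpha> N))) sequentially"
proof -
  obtain d where d: "1 - ln 2 < d" "ereal d < lower_density A"
    using ereal_dense2[OF dens] by auto
  have "eventually (\<lambda>N. ereal d < ereal (real (card {a \<in> A. a \<le> N}) / real N)) sequentially"
    using d(2) unfolding lower_density_def by (rule less_LiminfD)
  then have evd: "eventually (\<lambda>N. d * real N \<le> real (card {a \<in> A. a \<le> N})) sequentially"
    using eventually_gt_at_top[of 0]
  proof eventually_elim
    case (elim N)
    then show ?case by (simp add: pos_less_divide_eq)
  qed
  \<comment> \<open>The truncation at \<open>0\<close> makes \<open>ln (b / a) = (ln 2 + c0) / 2\<close> positive below, whatever the value of \<open>d\<close>.\<close>
  define c0 :: real where "c0 = max (1 - d) 0"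
  define \<delta> :: real where "\<delta> = ln 2 - c0"
  have \<delta>: "\<delta> > 0" "c0 \<ge> 0" "c0 \<ge> 1 - d" using d by (auto simp: \<delta>_def c0_def)
  define a where "a = exp (\<delta> / 4) / 2"
  define b where "b = exp (- \<delta> / 4)"
  define \<alpha> where "\<alpha> = (a + 1 / 2) / 2"
  have "exp (\<delta> / 4) > 1" using \<delta> by simp
  then have "a > 1 / 2" unfolding a_def by linarith
  then have a: "a > 1 / 2" "1 / 2 < \<alpha>" "\<alpha> < a" by (simp_all add: \<alpha>_def)
  have b: "b < 1" using \<delta> by (simp add: b_def)
  have lnba: "ln (b / a) = ln 2 - \<delta> / 2"
    by (simp add: a_def b_def ln_div ln_mult)
  then have "ln (b / a) > 0" using \<delta> unfolding \<delta>_def by (simp add: field_simps)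
  have "b > 0" by (simp add: b_def)
  then have ab: "a < b" using a \<open>ln (b / a) > 0\<close> by (simp add: ln_gt_zero_iff field_simps)
  have "c0 + \<delta> / 4 < ln (b / a)" unfolding lnba using \<delta>(1) \<delta>_def by linarith
  then have "eventually (\<lambda>N::nat. c0 + \<delta> / 4 <
       (\<Sum>p\<in>primes_between (real N powr a) (real N powr b). 1 / real p)) sequentially"
    using a ab by (intro eventually_sum_inverse_primes_gt) auto
  moreover have "eventually (\<lambda>N::nat. real N powr \<alpha> * real N powr (1 - a) \<le> \<delta> / 4 * real N - real N powr b) sequentially"
    using a b \<delta>(1) by real_asymp
  moreover note evd eventually_gt_at_top[of 0]
  ultimately have "eventually (\<lambda>N. real N powr \<alpha> \<le>
           real (card (large_primes (\<lambda>N. Lcm {a \<in> A. a \<le> N}) \<alpha> N))) sequentially"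
  proof eventually_elim
    case (elim N)
    let ?L = "\<lambda>\<alpha>. large_primes (\<lambda>N. Lcm {a \<in> A. a \<le> N}) \<alpha> N"
    have "\<delta> / 4 * real N - real N powr b \<le> (c0 + \<delta> / 4 + d - 1) * real N - real N powr b"
      using \<delta> by (intro diff_mono mult_right_mono) auto
    also have "\<dots> \<le> real (card (?L a)) * real N powr (1 - a)"
      using elim a ab by (intro card_large_primes_lower_bound A) auto
    finally have "real N powr \<alpha> * real N powr (1 - a) \<le> real (card (?L a)) * real N powr (1 - a)"
      using elim by linarith
    then have "real N powr \<alpha> \<le> real (card (?L a))" using elim by simp
    also have "card (?L a) \<le> card (?L \<alpha>)"
    proof (rule card_mono)
      have "finite {p. p dvd Lcm {a \<in> A. a \<le> N}}" by (rule finite_divisors_nat[OF Lcm_upto_pos[OF A]])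
      then show "finite (?L \<alpha>)" by (rule rev_finite_subset) (auto simp: large_primes_def)
      have "real N powr \<alpha> \<le> real N powr a" using elim a by (intro powr_mono) auto
      then show "?L a \<subseteq> ?L \<alpha>" by (auto simp: large_primes_def)
    qed
    finally show ?case by simp
  qed
  then show ?thesis using a by blast
qed

section \<open>Irrationality for divisor chains rich in primes\<close>

text \<open>
  This isolates what the irrationality argument uses, so that it serves the least common multiples of a
  dense set and the primorials alike. The bound on prime divisors ensures that a prime above \<open>m\<close>
  is new compared with \<open>l m\<close>.
\<close>
locale prime_rich_chain =
  fixes l :: "nat \<Rightarrow> nat" and \<alpha> :: real
  assumes pos: "l n > 0"
    and dvd_Suc: "l n dvd l (Suc n)"
    and prime_le: "prime p \<Longrightarrow> p dvd l n \<Longrightarrow> p \<le> n"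
    and alpha: "\<alpha> > 1 / 2"
    and rich: "eventually (\<lambda>N. real N powr \<alpha> \<le> real (card (large_primes l \<alpha> N))) sequentially"
begin

lemma dvd_mono: "m \<le> n \<Longrightarrow> l m dvd l n"
  by (induction n rule: dec_induct) (auto intro: dvd_trans dvd_Suc)

lemma finite_large_primes [simp]: "finite (large_primes l \<alpha> N)"
  by (rule finite_subset[of _ "{..N}"]) (auto simp: large_primes_def prime_le)

text \<open>
  A prime that divides \<open>l n\<close> but not \<open>l m\<close> divides the quotient \<open>l n div l m\<close>, so the product of
  any \<open>k\<close> of them does.
\<close>
lemma new_primes_growth:
  assumes "m \<le> n" "finite Q" "k \<le> card Q" "x \<ge> 0"
    and Q: "\<And>p. p \<in> Q \<Longrightarrow> prime p \<and> x \<le> real p \<and> p dvd l n \<and> \<not> p dvd l m"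
  shows   "x ^ k * real (l m) \<le> real (l n)"
proof -
  obtain R where R: "R \<subseteq> Q" "card R = k" "finite R"
    using obtain_subset_with_card_n[OF assms(3)] by blast
  obtain q where q: "l n = l m * q" using dvd_mono[OF assms(1)] by blast
  have "\<Prod>R dvd q"
  proof (rule prod_distinct_primes_dvd)
    fix p assume "p \<in> R"
    then have "prime p" "p dvd l m * q" "\<not> p dvd l m" using Q[of p] R q by auto
    then show "p dvd q" by (simp add: prime_dvd_mult_iff)
  qed (use R Q in auto)
  moreover have "q > 0" using q pos[of n] by (cases q) auto
  ultimately have "\<Prod>R \<le> q" by (rule dvd_imp_le)
  have "x ^ k = (\<Prod>p\<in>R. x)" using R by simp
  also have "\<dots> \<le> (\<Prod>p\<in>R. real p)"
  proof (rule prod_mono)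
    fix p assume "p \<in> R"
    then have "x \<le> real p" using Q[of p] R by blast
    then show "0 \<le> x \<and> x \<le> real p" using \<open>x \<ge> 0\<close> by blast
  qed
  also have "\<dots> = real (\<Prod>R)" by simp
  also have "\<dots> \<le> real q" using \<open>\<Prod>R \<le> q\<close> by (rule of_nat_mono)
  finally have "x ^ k * real (l m) \<le> real q * real (l m)" by (rule mult_right_mono) simp
  then show ?thesis by (simp add: q mult.commute)
qed

text \<open>
  The primes above \<open>k powr \<alpha> \<ge> sqrt k \<ge> m\<close> that divide \<open>l k\<close> cannot divide \<open>l m\<close>, and there are
  at least four of them, with product at least \<open>k powr (4 * \<alpha>) \<ge> k^2\<close>. For \<open>m = 0\<close> this yields the
  convergence of the series.
\<close>
lemma eventually_square_growth:
  "eventually (\<lambda>k. \<forall>m. m * m \<le> k \<longrightarrow> real k ^ 2 * real (l m) \<le> real (l k)) sequentially"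
proof -
  have "filterlim (\<lambda>k. real k powr \<alpha>) at_top sequentially"
    using alpha by real_asymp
  then have "eventually (\<lambda>k. real k powr \<alpha> \<ge> 4) sequentially"
    by (simp add: filterlim_at_top)
  with rich eventually_ge_at_top[of 1] show ?thesis
  proof eventually_elim
    case (elim k)
    have k: "real k \<ge> 1" using elim by simp
    show ?case
    proof (intro allI impI)
      fix m assume m: "m * m \<le> k"
      have "4 \<le> card (large_primes l \<alpha> k)" using elim by linarith
      have "real m = sqrt (real (m * m))" by simp
      also have "\<dots> \<le> sqrt (real k)" using m by (intro real_sqrt_le_mono) (simp only: of_nat_le_iff)
      also have "\<dots> = real k powr (1/2)" by (simp add: powr_half_sqrt)
      also have "\<dots> \<le> real k powr \<alpha>" using k alpha by (intro powr_mono) auto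
      finally have mk: "real m \<le> real k powr \<alpha>" .
      have "m \<le> m * m" by (cases m) auto
      then have "m \<le> k" using m by linarith
      have "(real k powr \<alpha>) ^ 4 * real (l m) \<le> real (l k)"
      proof (rule new_primes_growth[OF \<open>m \<le> k\<close> _ \<open>4 \<le> card (large_primes l \<alpha> k)\<close>])
        fix p assume p: "p \<in> large_primes l \<alpha> k"
        have "\<not> p dvd l m"
          using prime_le[of p m] p mk by (auto simp: large_primes_def)
        then show "prime p \<and> real k powr \<alpha> \<le> real p \<and> p dvd l k \<and> \<not> p dvd l m"
          using p by (auto simp: large_primes_def)
      qed auto
      moreover have "real k ^ 2 * real (l m) \<le> (real k powr \<alpha>) ^ 4 * real (l m)"
      proof (rule mult_right_mono)
        have "real k ^ 2 = real k powr 2" using k by simp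
        also have "\<dots> \<le> real k powr (\<alpha> * 4)" using k alpha by (intro powr_mono) auto
        also have "\<dots> = (real k powr \<alpha>) powr real 4" by (simp only: powr_powr of_nat_numeral)
        also have "\<dots> = (real k powr \<alpha>) ^ 4" using k by (intro powr_realpow) simp
        finally show "real k ^ 2 \<le> (real k powr \<alpha>) ^ 4" .
      qed simp
      ultimately show "real k ^ 2 * real (l m) \<le> real (l k)"
        by (rule order_trans[rotated])
    qed
  qed
qed

lemma summable_inverse: "summable (\<lambda>n. 1 / real (l n))"
proof (rule summable_comparison_test_ev)
  show "eventually (\<lambda>n. norm (1 / real (l n)) \<le> inverse (real n ^ 2)) sequentially"
    using eventually_square_growth eventually_gt_at_top[of 0]
  proof eventually_elim
    case (elim n)
    have "real n ^ 2 * 1 \<le> real n ^ 2 * real (l 0)"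
      using pos[of 0] by (intro mult_left_mono) auto
    also have "\<dots> \<le> real (l n)" using elim by simp
    finally have "inverse (real (l n)) \<le> inverse (real n ^ 2)"
      using elim(2) by (intro le_imp_inverse_le) auto
    then show ?case by (simp add: inverse_eq_divide)
  qed
  show "summable (\<lambda>n. inverse (real n ^ 2))" by (rule inverse_power_summable) simp
qed

text \<open>
  Multiplying a sum with denominator \<open>b\<close> by \<open>b * l m\<close> makes both the sum and its terms up to
  \<open>m\<close> integers, so the rest is a positive integer.
\<close>
lemma rational_imp_tails_bounded_below:
  assumes "(\<Sum>n. 1 / real (l n)) \<in> \<rat>"
  shows   "\<exists>\<epsilon>>0. \<forall>m. \<epsilon> \<le> (\<Sum>i. real (l m) / real (l (i + Suc m)))"
proof -
  obtain a b' :: int where ab': "b' > 0" "(\<Sum>n. 1 / real (l n)) = of_int a / of_int b'"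
    using assms by (rule Rats_cases')
  define b where "b = nat b'"
  have ab: "b > 0" "(\<Sum>n. 1 / real (l n)) = of_int a / real b"
    using ab' by (simp_all add: b_def)
  have "1 / real b \<le> (\<Sum>i. real (l m) / real (l (i + Suc m)))" for m
  proof -
    let ?T = "\<Sum>i. 1 / real (l (i + Suc m))"
    have summ: "summable (\<lambda>i. 1 / real (l (i + Suc m)))"
      using summable_inverse by (subst summable_iff_shift)
    have T: "?T > 0" by (rule suminf_pos[OF summ]) (use pos in simp)
    have tail: "(\<Sum>i. real (l m) / real (l (i + Suc m))) = real (l m) * ?T"
      using suminf_mult[OF summ, of "real (l m)"] by simp
    define z where "z = int (l m) * a - (\<Sum>k<Suc m. int b * int (l m div l k))"
    have "real b * real (l m) * (\<Sum>k<Suc m. 1 / real (l k)) = (\<Sum>k<Suc m. real b * real (l m div l k))"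
      unfolding sum_distrib_left
    proof (rule sum.cong)
      fix k assume "k \<in> {..<Suc m}"
      then have "l k dvd l m" by (intro dvd_mono) auto
      then show "real b * real (l m) * (1 / real (l k)) = real b * real (l m div l k)"
        by (simp add: real_of_nat_div)
    qed simp
    moreover have "of_int a / real b = (\<Sum>k<Suc m. 1 / real (l k)) + ?T"
      using suminf_split_initial_segment[OF summable_inverse, of "Suc m"] ab by simp
    then have "real b * real (l m) * (of_int a / real b)
       = real b * real (l m) * (\<Sum>k<Suc m. 1 / real (l k)) + real b * real (l m) * ?T"
      by (simp only: distrib_left)
    ultimately have z: "real b * (real (l m) * ?T) = of_int z"
      using ab by (simp add: z_def)
    moreover have "real b * (real (l m) * ?T) > 0" using T ab pos[of m] by simp
    ultimately have "z \<ge> 1" by simp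
    then have "1 \<le> real b * (real (l m) * ?T)" unfolding z by simp
    then show ?thesis unfolding tail using ab by (simp add: field_simps)
  qed
  then show ?thesis using ab by (intro exI[of _ "1 / real b"]) auto
qed

text \<open>
  Pigeonhole principle for the times \<open>e p\<close> at which the large primes enter the chain, distributed over the
  \<open>M + 1\<close> blocks of length \<open>M\<close> that cover \<open>{0..M * M}\<close>. Four primes are what the tail
  estimate needs: beyond the block the quotients must outweigh the \<open>(M * M)^2\<close> terms of the middle range,
  and four factors larger than \<open>(M * M) powr \<alpha>\<close> do so because \<open>4 * \<alpha> > 2\<close>.
\<close>
lemma exists_four_clustered_primes:
  assumes M: "M > 0" and card: "3 * (real M + 1) < real (card (large_primes l \<alpha> (M * M)))"
  shows   "\<exists>m F. m < M * M \<and> F \<subseteq> large_primes l \<alpha> (M * M) \<and> 4 \<le> card F \<and>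
             (\<forall>p\<in>F. \<not> p dvd l m \<and> p dvd l (m + M)) \<and> (\<exists>p\<in>F. p dvd l (Suc m))"
proof -
  let ?Q = "large_primes l \<alpha> (M * M)"
  define e where "e = (\<lambda>p. LEAST k. p dvd l k)"
  have e: "p dvd l (e p)" "e p \<le> M * M" "e p > 0" "\<And>k. k < e p \<Longrightarrow> \<not> p dvd l k" if "p \<in> ?Q" for p
  proof -
    have p: "prime p" "p dvd l (M * M)" using that by (auto simp: large_primes_def)
    show *: "p dvd l (e p)" unfolding e_def using p(2) by (rule LeastI)
    show "e p \<le> M * M" unfolding e_def using p(2) by (rule Least_le)
    show "e p > 0" using prime_le[OF p(1) *] prime_gt_0_nat[OF p(1)] by simp
    show "\<not> p dvd l k" if "k < e p" for k using that unfolding e_def by (rule not_less_Least)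
  qed
  have "\<exists>j\<le>M. 4 \<le> card {p \<in> ?Q. e p div M = j}"
  proof (rule ccontr)
    assume "\<not> ?thesis"
    then have small: "card {p \<in> ?Q. e p div M = j} \<le> 3" if "j \<le> M" for j using that by force
    have "e p div M \<le> M" if "p \<in> ?Q" for p
      using div_le_mono[OF e(2)[OF that], of M] M by simp
    then have "?Q = (\<Union>j\<in>{..M}. {p \<in> ?Q. e p div M = j})" by auto
    then have "card ?Q = card (\<Union>j\<in>{..M}. {p \<in> ?Q. e p div M = j})" by (rule arg_cong)
    also have "\<dots> \<le> (\<Sum>j\<le>M. card {p \<in> ?Q. e p div M = j})" by (rule card_UN_le) simp
    also have "\<dots> \<le> (\<Sum>j\<le>M. 3)" by (intro sum_mono small) auto
    finally show False using card by simp
  qed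
  then obtain j where j: "4 \<le> card {p \<in> ?Q. e p div M = j}" by blast
  define F where "F = {p \<in> ?Q. e p div M = j}"
  have "F \<noteq> {}" using j by (intro notI) (simp flip: F_def)
  then have F: "finite F" "F \<noteq> {}" "F \<subseteq> ?Q" by (auto simp: F_def)
  \<comment> \<open>At index \<open>s - 1\<close> none of the chosen primes has entered, one index later the first has,
    and by index \<open>s - 1 + M\<close> all have, since they enter in the same block.\<close>
  define s where "s = Min (e ` F)"
  have "s \<in> e ` F" unfolding s_def using F by (intro Min_in) auto
  then obtain p0 where p0: "p0 \<in> F" "e p0 = s" by auto
  have s_le: "s \<le> e p" if "p \<in> F" for p unfolding s_def using F that by simp
  have s0: "s > 0" "s \<le> M * M" using e(2,3)[of p0] p0 F by auto
  have "p dvd l (s - 1 + M)" if "p \<in> F" for p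
  proof -
    have "e p div M = s div M" using that p0 by (simp add: F_def)
    then have "e p < s + M"
    proof -
      have "e p = s div M * M + e p mod M"
        using div_mult_mod_eq[of "e p" M] \<open>e p div M = s div M\<close> by simp
      moreover have "s div M * M \<le> s" by simp
      moreover have "e p mod M < M" using M by simp
      ultimately show ?thesis by linarith
    qed
    then have "e p \<le> s - 1 + M" using s0 by linarith
    then show ?thesis using e(1)[of p] that F dvd_mono dvd_trans by blast
  qed
  moreover have "\<not> p dvd l (s - 1)" if "p \<in> F" for p
  proof (rule e(4))
    show "p \<in> ?Q" using that F by blast
    show "s - 1 < e p" using s_le[OF that] s0 by linarith
  qed
  moreover have "p0 dvd l (Suc (s - 1))" using e(1)[of p0] p0 F s0 by auto
  ultimately show ?thesis
    using p0 s0 F j by (intro exI[of _ "s - 1"] exI[of _ F]) (auto simp: F_def)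
qed

text \<open>
  With \<open>N = M * M\<close> and \<open>m\<close> just before a cluster of four primes larger than \<open>M powr \<beta>\<close>, where
  \<open>\<beta> = 2 * \<alpha> > 1\<close>, the tail is at most
  \<open>M / M powr \<beta> + M^4 / (M powr \<beta>)^4 + (\<Sum>i\<ge>M^4. 1 / i^2)\<close>: one prime controls the \<open>M\<close>
  terms inside the block, four primes those up to \<open>M^4\<close>, and the growth of the chain the others.
\<close>
lemma exists_small_tail:
  assumes "\<epsilon> > 0"
  shows   "\<exists>m. (\<Sum>i. real (l m) / real (l (i + Suc m))) < \<epsilon>"
proof -
  define \<beta> where "\<beta> = 2 * \<alpha>"
  have beta: "\<beta> > 1" using alpha by (simp add: \<beta>_def)
  let ?sq = "\<lambda>i::nat. inverse (real i ^ 2)"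
  have sq: "summable ?sq" by (rule inverse_power_summable) simp
  obtain n0 where n0: "\<And>n. n \<ge> n0 \<Longrightarrow> norm (\<Sum>i. ?sq (i + n)) < \<epsilon> / 2"
    using suminf_exist_split[of "\<epsilon> / 2", OF _ sq] assms by auto
  have sqM: "filterlim (\<lambda>M::nat. M * M) at_top sequentially"
    by (rule filterlim_at_top_mono[OF filterlim_ident]) (auto intro!: always_eventually)
  have fourM: "filterlim (\<lambda>M::nat. (M * M) * (M * M)) at_top sequentially"
    by (rule filterlim_compose[OF sqM sqM])
  have "eventually (\<lambda>M. real (M * M) powr \<alpha> \<le> real (card (large_primes l \<alpha> (M * M)))) sequentially"
    using rich sqM by (rule eventually_compose_filterlim)
  moreover have "eventually (\<lambda>M::nat. 3 * (real M + 1) < real M powr \<beta>) sequentially"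
    using beta by real_asymp
  moreover have "((\<lambda>M::nat. real M / real M powr \<beta> + real M ^ 4 / (real M powr \<beta>) ^ 4) \<longlongrightarrow> 0) sequentially"
    using beta by real_asymp
  then have "eventually (\<lambda>M::nat. real M / real M powr \<beta> + real M ^ 4 / (real M powr \<beta>) ^ 4 < \<epsilon> / 2) sequentially"
    using assms by (intro order_tendstoD) auto
  moreover have "eventually (\<lambda>M::nat. \<forall>k\<ge>(M * M) * (M * M). k \<ge> n0 \<and>
       (\<forall>m. m * m \<le> k \<longrightarrow> real k ^ 2 * real (l m) \<le> real (l k))) sequentially"
    using eventually_all_ge_at_top[OF eventually_conj[OF eventually_ge_at_top[of n0] eventually_square_growth]] fourM
    by (rule eventually_compose_filterlim)
  moreover have "eventually (\<lambda>M::nat. M > 0) sequentially" by (rule eventually_gt_at_top)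
  ultimately have "eventually (\<lambda>M. \<exists>m. (\<Sum>i. real (l m) / real (l (i + Suc m))) < \<epsilon>) sequentially"
  proof eventually_elim
    case (elim M)
    let ?X = "real M powr \<beta>"
    have M: "real M > 0" using elim by simp
    have X: "real (M * M) powr \<alpha> = ?X" using M by (simp add: powr_mult \<beta>_def flip: powr_add)
    have X0: "?X > 0" using M by simp
    have "3 * (real M + 1) < real (card (large_primes l \<alpha> (M * M)))"
      using elim X by linarith
    from exists_four_clustered_primes[OF _ this] elim
    obtain m F where mF: "m < M * M" "F \<subseteq> large_primes l \<alpha> (M * M)" "4 \<le> card F"
        "\<And>p. p \<in> F \<Longrightarrow> \<not> p dvd l m \<and> p dvd l (m + M)" "\<exists>p\<in>F. p dvd l (Suc m)"
      by blast
    have F: "finite F" "\<And>p. p \<in> F \<Longrightarrow> prime p \<and> ?X \<le> real p"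
      using mF(2) X finite_subset[OF mF(2) finite_large_primes] by (auto simp: large_primes_def)
    let ?f = "\<lambda>i. real (l m) / real (l (i + Suc m))"
    let ?K = "(M * M) * (M * M)"
    have f: "summable ?f"
      using summable_mult[OF summable_inverse[THEN summable_ignore_initial_segment], of "real (l m)" "Suc m"] by simp
    have one: "?f i \<le> 1 / ?X" for i
    proof -
      obtain p where p: "p \<in> F" "p dvd l (Suc m)" using mF by blast
      have "p dvd l (i + Suc m)" using p dvd_mono[of "Suc m" "i + Suc m"] by auto
      then have "?X ^ 1 * real (l m) \<le> real (l (i + Suc m))"
        using p F mF(4)[of p] X0 by (intro new_primes_growth[where Q = "{p}"]) auto
      then show ?thesis using X0 pos[of "i + Suc m"] by (simp add: field_simps)
    qed
    have four: "?f i \<le> 1 / ?X ^ 4" if "i \<ge> M" for i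
    proof -
      have "?X ^ 4 * real (l m) \<le> real (l (i + Suc m))"
      proof (rule new_primes_growth[OF _ F(1) mF(3)])
        fix p assume p: "p \<in> F"
        have "p dvd l (i + Suc m)"
          using mF(4)[OF p] dvd_mono[of "m + M" "i + Suc m"] that by (auto intro: dvd_trans)
        then show "prime p \<and> ?X \<le> real p \<and> p dvd l (i + Suc m) \<and> \<not> p dvd l m"
          using mF(4)[OF p] F(2)[OF p] by auto
      qed auto
      then show ?thesis using X0 pos[of "i + Suc m"] by (simp add: field_simps)
    qed
    have far: "?f (i + ?K) \<le> ?sq (i + ?K)" for i
    proof -
      let ?k = "i + ?K + Suc m"
      have "m * m \<le> ?K" using mF(1) by (intro mult_mono) auto
      then have "m * m \<le> ?k" by linarith
      moreover have "?k \<ge> ?K" by simp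
      ultimately have "real ?k ^ 2 * real (l m) \<le> real (l ?k)" using elim(4) by blast
      moreover have "real (i + ?K) ^ 2 * real (l m) \<le> real ?k ^ 2 * real (l m)"
        by (intro mult_right_mono power_mono) auto
      ultimately have "real (i + ?K) ^ 2 * real (l m) \<le> real (l ?k)"
        by (rule order_trans[rotated])
      moreover have "i + ?K > 0" using elim(5) by simp
      then have "real (i + ?K) > 0" by (simp only: of_nat_0_less_iff)
      ultimately show ?thesis using pos[of ?k] by (simp add: field_simps)
    qed
    have "suminf ?f = (\<Sum>i. ?f (i + ?K)) + (\<Sum>i<?K. ?f i)"
      by (rule suminf_split_initial_segment[OF f])
    also have "(\<Sum>i. ?f (i + ?K)) \<le> (\<Sum>i. ?sq (i + ?K))"
      using summable_ignore_initial_segment[OF f, of ?K] summable_ignore_initial_segment[OF sq, of ?K]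
      by (intro suminf_le far)
    also have "\<dots> < \<epsilon> / 2" using n0[of ?K] elim by auto
    also have "(\<Sum>i<?K. ?f i) \<le> (\<Sum>i<?K. (if i < M then 1 / ?X else 0) + 1 / ?X ^ 4)"
    proof (rule sum_mono)
      fix i show "?f i \<le> (if i < M then 1 / ?X else 0) + 1 / ?X ^ 4"
        using one[of i] four[of i] X0 by (cases "i < M") (auto intro: add_increasing2)
    qed
    also have "\<dots> \<le> real M / ?X + real M ^ 4 / ?X ^ 4"
    proof -
      have "(\<Sum>i<?K. if i < M then 1 / ?X else 0) = (\<Sum>i\<in>{i\<in>{..<?K}. i < M}. 1 / ?X)"
        by (rule sum.inter_filter[symmetric]) simp
      also have "\<dots> \<le> (\<Sum>i<M. 1 / ?X)" using X0 by (intro sum_mono2) auto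
      finally show ?thesis by (simp add: sum.distrib power4_eq_xxxx mult.assoc)
    qed
    also have "\<dots> < \<epsilon> / 2" using elim by blast
    finally have "suminf ?f < \<epsilon>" by simp
    then show ?case by blast
  qed
  then show ?thesis using eventually_happens'[OF sequentially_bot] by blast
qed

lemma irrational_sum_inverse: "(\<Sum>n. 1 / real (l n)) \<notin> \<rat>"
  using rational_imp_tails_bounded_below exists_small_tail by (meson not_less)

end

section \<open>The mean value of \<open>tau\<close>\<close>

lemma tau_gt_iff:
  assumes A: "infinite A" and n: "n > 0"
  shows   "m < tau A n \<longleftrightarrow> Lcm {a \<in> A. a \<le> m} dvd n"
proof -
  obtain a0 where a0: "a0 \<in> A" "a0 > n"
    using A by (meson infinite_nat_iff_unbounded)
  then have "\<not> a0 dvd n" using n by (auto dest: dvd_imp_le)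
  with a0 have ex: "\<exists>a. a \<in> A \<and> \<not> a dvd n" by blast
  have tau: "tau A n \<in> A \<and> \<not> tau A n dvd n" unfolding tau_def using ex by (rule LeastI_ex)
  show ?thesis
  proof
    assume m: "m < tau A n"
    show "Lcm {a \<in> A. a \<le> m} dvd n"
    proof (rule Lcm_least)
      fix a assume a: "a \<in> {a \<in> A. a \<le> m}"
      then have "a < tau A n" using m by simp
      then show "a dvd n" unfolding tau_def using not_less_Least[of a "\<lambda>a. a \<in> A \<and> \<not> a dvd n"] a by blast
    qed
  next
    assume dvd: "Lcm {a \<in> A. a \<le> m} dvd n"
    show "m < tau A n"
    proof (rule ccontr)
      assume "\<not> m < tau A n"
      then have "tau A n dvd Lcm {a \<in> A. a \<le> m}" using tau by (intro dvd_Lcm) auto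
      with dvd tau show False by (blast intro: dvd_trans)
    qed
  qed
qed

text \<open>
  Write \<open>tau A n\<close> as the number of \<open>m < tau A n\<close>, that is, of \<open>m\<close> such that \<open>l m\<close> divides
  \<open>n\<close>, and exchange the two summations.
\<close>
lemma sum_tau_eq:
  fixes A :: "nat set"
  assumes A: "infinite A" "\<forall>a\<in>A. 0 < a"
  defines "l \<equiv> \<lambda>m. Lcm {a \<in> A. a \<le> m}"
  shows   "(\<Sum>n=1..N. real (tau A n)) = (\<Sum>m. real (N div l m))"
proof -
  have l_pos: "l m > 0" for m
    unfolding l_def by (rule Lcm_upto_pos[OF A(2)])
  \<comment> \<open>Any common upper bound for the values \<open>tau A n\<close> makes the sum over \<open>m\<close> finite.\<close>
  define K where "K = (\<Sum>n=1..N. tau A n)"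
  have K: "tau A n \<le> K" if "n \<in> {1..N}" for n
    unfolding K_def using that by (intro member_le_sum) auto
  have "(\<Sum>n=1..N. tau A n) = (\<Sum>n=1..N. \<Sum>m<K. if l m dvd n then 1 else 0)"
  proof (rule sum.cong)
    fix n assume n: "n \<in> {1..N}"
    then have iff: "l m dvd n \<longleftrightarrow> m < tau A n" for m
      unfolding l_def using A tau_gt_iff[of A n m] by auto
    have "(\<Sum>m<K. if l m dvd n then 1 else 0) = (\<Sum>m\<in>{m\<in>{..<K}. m < tau A n}. 1::nat)"
      unfolding iff by (rule sum.inter_filter[symmetric]) simp
    also have "{m\<in>{..<K}. m < tau A n} = {..<tau A n}" using K[OF n] by auto
    finally show "tau A n = (\<Sum>m<K. if l m dvd n then 1 else 0)" by simp
  qed simp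
  also have "\<dots> = (\<Sum>m<K. \<Sum>n=1..N. if l m dvd n then 1 else 0)" by (rule sum.swap)
  also have "\<dots> = (\<Sum>m<K. N div l m)"
  proof (rule sum.cong)
    fix m
    have "(\<Sum>n=1..N. if l m dvd n then 1 else 0) = card {n \<in> {1..N}. l m dvd n}"
      by (simp flip: sum.inter_filter)
    also have "\<dots> = N div l m" by (rule card_multiples[OF l_pos])
    finally show "(\<Sum>n=1..N. if l m dvd n then 1 else 0) = N div l m" .
  qed simp
  finally have "(\<Sum>n=1..N. real (tau A n)) = (\<Sum>m<K. real (N div l m))"
    by (simp only: flip: of_nat_sum)
  also have "\<dots> = (\<Sum>m. real (N div l m))"
  proof (rule suminf_finite[symmetric])
    fix m assume m: "m \<notin> {..<K}"
    have "{n \<in> {1..N}. l m dvd n} = {}"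
    proof -
      have "\<not> l m dvd n" if n: "n \<in> {1..N}" for n
        using tau_gt_iff[of A n m] A n K[OF n] m by (auto simp: l_def)
      then show ?thesis by blast
    qed
    then have "N div l m = card ({} :: nat set)" by (simp only: card_multiples[OF l_pos, symmetric])
    then show "real (N div l m) = 0" by simp
  qed simp
  finally show ?thesis .
qed

lemma mean_div_tendsto:
  fixes d :: nat
  assumes "d > 0"
  shows   "(\<lambda>N. real (N div d) / real N) \<longlonglongrightarrow> 1 / real d"
proof (rule tendsto_sandwich)
  show "eventually (\<lambda>N. 1 / real d - 1 / real N \<le> real (N div d) / real N) sequentially"
    using eventually_gt_at_top[of 0]
  proof eventually_elim
    case (elim N)
    have "real N / real d - 1 \<le> real (N div d)"
      using floor_divide_of_nat_eq[of N d, where ?'a = real] by linarith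
    then have "(real N / real d - 1) / real N \<le> real (N div d) / real N"
      by (rule divide_right_mono) simp
    then show ?case using elim by (simp add: diff_divide_distrib)
  qed
  show "eventually (\<lambda>N. real (N div d) / real N \<le> 1 / real d) sequentially"
    using eventually_gt_at_top[of 0]
  proof eventually_elim
    case (elim N)
    have "real (N div d) / real N \<le> (real N / real d) / real N"
      by (intro divide_right_mono of_nat_div_le_of_nat) simp
    then show ?case using elim by simp
  qed
  show "(\<lambda>N. 1 / real d - 1 / real N) \<longlonglongrightarrow> 1 / real d" by real_asymp
qed simp

text \<open>
  Tannery's theorem applies to the preceding formula divided by \<open>N\<close>: the term \<open>(N div l m) / N\<close> tends to
  \<open>1 / l m\<close> and is dominated by it.
\<close>
lemma average_tau:
  fixes A :: "nat set"
  assumes A: "infinite A" "\<forall>a\<in>A. 0 < a"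
  defines "l \<equiv> \<lambda>m. Lcm {a \<in> A. a \<le> m}"
  assumes summ: "summable (\<lambda>m. 1 / real (l m))"
  shows   "(\<lambda>N. (1 / real N) * (\<Sum>n=1..N. real (tau A n))) \<longlonglongrightarrow> (\<Sum>m. 1 / real (l m))"
proof -
  have l_pos: "l m > 0" for m
    unfolding l_def by (rule Lcm_upto_pos[OF A(2)])
  have bound: "real (N div l m) / real N \<le> 1 / real (l m)" for N m
  proof (cases "N = 0")
    case False
    have "real (N div l m) / real N \<le> (real N / real (l m)) / real N"
      by (intro divide_right_mono of_nat_div_le_of_nat) simp
    then show ?thesis using False by simp
  qed simp
  have "eventually (\<lambda>N. summable (\<lambda>m. norm (real (N div l m) / real N))) sequentially \<and>
        summable (\<lambda>m. norm (1 / real (l m))) \<and>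
        (\<lambda>N. \<Sum>m. real (N div l m) / real N) \<longlonglongrightarrow> (\<Sum>m. 1 / real (l m))"
  proof (rule tannerys_theorem[OF _ _ summ])
    show "(\<lambda>N. real (N div l m) / real N) \<longlonglongrightarrow> 1 / real (l m)" for m
      using l_pos by (rule mean_div_tendsto)
    show "eventually (\<lambda>(m, N). norm (real (N div l m) / real N) \<le> 1 / real (l m)) (at_top \<times>\<^sub>F sequentially)"
      using bound by (auto intro!: always_eventually)
  qed simp
  then have "(\<lambda>N. \<Sum>m. real (N div l m) / real N) \<longlonglongrightarrow> (\<Sum>m. 1 / real (l m))" by blast
  moreover have "(\<Sum>m. real (N div l m) / real N) = (1 / real N) * (\<Sum>n=1..N. real (tau A n))" for N
  proof (cases "N = 0")
    case False
    have "summable (\<lambda>m. real (N div l m) / real N)"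
      by (rule summable_comparison_test'[OF summ, of 0]) (use bound in auto)
    then have "summable (\<lambda>m. real N * (real (N div l m) / real N))" by (rule summable_mult)
    then have "summable (\<lambda>m. real (N div l m))" using False by simp
    then show ?thesis using sum_tau_eq[OF A, of N] by (simp add: suminf_divide l_def)
  qed simp
  ultimately show ?thesis by simp
qed

section \<open>The three chains\<close>

lemma lcm_chain_prime_rich:
  assumes A: "\<forall>a\<in>A. 0 < a" and dens: "lower_density A > ereal (1 - ln 2)"
  shows   "\<exists>\<alpha>. prime_rich_chain (\<lambda>N. Lcm {a \<in> A. a \<le> N}) \<alpha>"
proof -
  obtain \<alpha> where \<alpha>: "\<alpha> > 1 / 2" "eventually (\<lambda>N. real N powr \<alpha> \<le>
           real (card (large_primes (\<lambda>N. Lcm {a \<in> A. a \<le> N}) \<alpha> N))) sequentially"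
    using density_imp_many_large_primes[OF A dens] by blast
  have "prime_rich_chain (\<lambda>N. Lcm {a \<in> A. a \<le> N}) \<alpha>"
  proof
    show "Lcm {a \<in> A. a \<le> n} > 0" for n by (rule Lcm_upto_pos[OF A])
    show "Lcm {a \<in> A. a \<le> n} dvd Lcm {a \<in> A. a \<le> Suc n}" for n
      by (rule Lcm_subset) auto
    show "p \<le> n" if p: "prime p" "p dvd Lcm {a \<in> A. a \<le> n}" for p n
    proof -
      have "Lcm {a \<in> A. a \<le> n} dvd fact n"
        using A by (intro Lcm_least dvd_fact) (auto simp: Suc_le_eq)
      then have "p dvd fact n" using p by (blast intro: dvd_trans)
      then show ?thesis using p by (simp add: prime_dvd_fact_iff)
    qed
  qed (use \<alpha> in auto)
  then show ?thesis by blast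
qed

lemma positive_integers_chain_prime_rich: "\<exists>\<alpha>. prime_rich_chain (\<lambda>n. Lcm {1..n}) \<alpha>"
proof -
  have "lower_density {1..} = 1"
    unfolding lower_density_def
  proof (intro lim_imp_Liminf tendsto_eventually)
    show "eventually (\<lambda>N. ereal (real (card {a \<in> {1..}. a \<le> N}) / real N) = 1) sequentially"
      using eventually_gt_at_top[of 0]
    proof eventually_elim
      case (elim N)
      have "{a \<in> {1..}. a \<le> N} = {1..N}" by auto
      then show ?case using elim by (simp add: one_ereal_def)
    qed
  qed simp
  then have "lower_density {1..} > ereal (1 - ln 2)"
    by (simp add: one_ereal_def)
  then have "\<exists>\<alpha>. prime_rich_chain (\<lambda>N. Lcm {a \<in> {1..}. a \<le> N}) \<alpha>"
    by (intro lcm_chain_prime_rich) auto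
  moreover have "{a \<in> {1..}. a \<le> n} = {1..n}" for n :: nat by auto
  ultimately show ?thesis by simp
qed

text \<open>
  The set of primes itself has density zero and falls outside the density criterion, but the primorial of
  \<open>n\<close> has the same prime divisors as \<open>Lcm {1..n}\<close>.
\<close>
lemma primorial_chain_prime_rich: "\<exists>\<alpha>. prime_rich_chain (\<lambda>n. \<Prod>p | prime p \<and> p \<le> n. p) \<alpha>"
proof -
  let ?l = "\<lambda>n. \<Prod>p | prime p \<and> p \<le> n. p :: nat"
  obtain \<alpha> where "prime_rich_chain (\<lambda>n. Lcm {1..n}) \<alpha>"
    using positive_integers_chain_prime_rich by blast
  then interpret L: prime_rich_chain "\<lambda>n. Lcm {1..n}" \<alpha> .
  have fin: "finite {p::nat. prime p \<and> p \<le> n}" for n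
    by (rule finite_subset[of _ "{..n}"]) auto
  have dvd_iff: "p dvd ?l n \<longleftrightarrow> p \<le> n" if "prime p" for p n
  proof
    assume "p dvd ?l n"
    then show "p \<le> n"
      using that fin[of n] by (auto simp: prime_dvd_prod_iff dest: primes_dvd_imp_eq)
  next
    assume "p \<le> n"
    then show "p dvd ?l n" using that fin[of n] by (intro dvd_prodI) auto
  qed
  have subset: "large_primes (\<lambda>n. Lcm {1..n}) \<alpha> N \<subseteq> large_primes ?l \<alpha> N" for N
    using L.prime_le[of _ N] dvd_iff[of _ N] by (auto simp: large_primes_def)
  have "prime_rich_chain ?l \<alpha>"
  proof
    show "?l n > 0" for n by (intro prod_pos) (auto simp: prime_gt_0_nat)
    show "?l n dvd ?l (Suc n)" for n by (rule prod_dvd_prod_subset) (auto simp: fin)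
    show "p \<le> n" if "prime p" "p dvd ?l n" for p n using that dvd_iff by blast
    show "\<alpha> > 1 / 2" by (rule L.alpha)
    show "eventually (\<lambda>N. real N powr \<alpha> \<le> real (card (large_primes ?l \<alpha> N))) sequentially"
      using L.rich
    proof eventually_elim
      case (elim N)
      have "finite (large_primes ?l \<alpha> N)"
        by (rule finite_subset[of _ "{..N}"]) (auto simp: large_primes_def dvd_iff)
      then have "card (large_primes (\<lambda>n. Lcm {1..n}) \<alpha> N) \<le> card (large_primes ?l \<alpha> N)"
        using subset by (rule card_mono)
      then show ?case using elim by linarith
    qed
  qed
  then show ?thesis by blast
qed

theorem proposition1:
  "(\<forall>A :: nat set.
      infinite A \<longrightarrow> (\<forall>a\<in>A. 0 < a) \<longrightarrow> lower_density A > ereal (1 - ln 2) \<longrightarrow>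
      (\<exists>L :: real. (\<lambda>N. (1 / real N) * (\<Sum>n=1..N. real (tau A n))) \<longlonglongrightarrow> L \<and> L \<notin> \<rat>))
   \<and> (summable ell1_term \<and> ell1 \<notin> \<rat>)
   \<and> (summable ell2_term \<and> ell2 \<notin> \<rat>)"
proof (intro conjI allI impI)
  fix A :: "nat set"
  assume A: "infinite A" "\<forall>a\<in>A. 0 < a" and "lower_density A > ereal (1 - ln 2)"
  then obtain \<alpha> where "prime_rich_chain (\<lambda>N. Lcm {a \<in> A. a \<le> N}) \<alpha>"
    using lcm_chain_prime_rich by blast
  then interpret prime_rich_chain "\<lambda>N. Lcm {a \<in> A. a \<le> N}" \<alpha> .
  show "\<exists>L :: real. (\<lambda>N. (1 / real N) * (\<Sum>n=1..N. real (tau A n))) \<longlonglongrightarrow> L \<and> L \<notin> \<rat>"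
    using average_tau[OF A summable_inverse] irrational_sum_inverse by blast
next
  obtain \<alpha> where "prime_rich_chain (\<lambda>n. Lcm {1..n}) \<alpha>"
    using positive_integers_chain_prime_rich by blast
  then interpret prime_rich_chain "\<lambda>n. Lcm {1..n}" \<alpha> .
  show "summable ell1_term" using summable_inverse by (simp add: ell1_term_def [abs_def])
  show "ell1 \<notin> \<rat>" using irrational_sum_inverse by (simp add: ell1_def ell1_term_def)
next
  obtain \<alpha> where "prime_rich_chain (\<lambda>n. \<Prod>p | prime p \<and> p \<le> n. p) \<alpha>"
    using primorial_chain_prime_rich by blast
  then interpret prime_rich_chain "\<lambda>n. \<Prod>p | prime p \<and> p \<le> n. p" \<alpha> .
  show "summable ell2_term" using summable_inverse by (simp only: ell2_term_def [abs_def])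
  show "ell2 \<notin> \<rat>" using irrational_sum_inverse by (simp only: ell2_def ell2_term_def)  simp
qed

end
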